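(* Consider a college admissions problem with college-specific eligibility sets $A_c\subseteq I$ ($c\in C$) and a common strict priority order $\triangleright_0$ (induced by scores) among eligible students, and let students follow (eligibility-modified) straightforward strategies in the time-constrained dynamic mechanism (TCDM). Then: 1. The stable matching is unique and coincides with the outcome of serial dictatorship following $\triangleright_0$ subject to eligibility. The process reaches the unique stable matching after at most $|I|$ rounds; in particular, if $T\ge|I|$ the final matching of the $T$-round TCDM is the unique stable matching. 2. If $T\ge |I|$, the profile of straightforward strategies is a Nash equilibrium of the complete-information game induced by the $T$-round TCDM. 3. For every $T\ge1$, if $\mu^{TCDM(T)}(i)\succ_i\mu^{DA}(i)$ for a student $i$, then there is a student $j$ with $j\triangleright_0 i$ and $\mu^{TCDM(T)}(j)=\emptyset$. 4. For every $T\ge1$, every probability distribution over preference profiles and every student $i$, $p_{i,1}^{TCDM(T)}\ge p_{i,1}^{DA}$. 5. For every $T\ge1$ and every probability distribution over preference profiles, $p_{i,1}^{TCDM(T)}\ge p_{i,1}^{TCDM(T+1)}$ for every student $i$, and $\sum_{i\in I}\sum_{l\ge2}p_{i,l}^{TCDM(T)}\le\sum_{i\in I}\sum_{l\ge2}p_{i,l}^{TCDM(T+1)}$.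
   Context: Problem. $I$ is a finite set of students and $C$ a finite set of colleges. Each student $i$ has a strict preference (linear order) $\succ_i$ over $C\cup\{\emptyset\}$, where $\emptyset$ is the outside option (being unassigned). Each college $c$ has capacity $q_c\in\mathbb{N}_+$. Each student has a score $s_i>0$, scores are distinct, and $i\triangleright_0 j\iff s_i>s_j$. Each college $c$ has a set $A_c\subseteq I$ of eligible students, which is common knowledge; students in $A_c$ are ranked by $c$ according to $\triangleright_0$, and a student outside $A_c$ is rejected by $c$ regardless of capacity or cutoff. Matching and stability. A matching is a map $\mu:I\to C\cup\{\emptyset\}$ with $|\mu^{-1}(c)|\le q_c$ and $\mu^{-1}(c)\subseteq A_c$ for all $c$. Student $i$ blocks $\mu$ if $\emptyset\succ_i\mu(i)$. A pair $(i,c)$ with $i\in A_c$ blocks $\mu$ if $c\succ_i\mu(i)$ and either $|\mu^{-1}(c)|<q_c$ or there is $j\in\mu^{-1}(c)$ with $i\triangleright_0 j$; pairs with $i\notin A_c$ never block. $\mu$ is stable if nothing blocks it. The cutoff of $c$ at $\mu$ is $f_c(\mu)=\min\{s_i:i\in\mu^{-1}(c)\}$ if $|\mu^{-1}(c)|=q_c$, and $f_c(\mu)=0$ otherwise. Serial dictatorship following $\triangleright_0$ subject to eligibility: students, from highest to lowest priority, each receive their most-preferred option among $\emptyset$ and the colleges for which they are eligible that still have a vacant seat. DA is student-proposing deferred acceptance with true preferences, each college tentatively holding its highest-priority eligible applicants up to capacity and rejecting all others; its outcome is $\mu^{DA}$. TCDM with $T$ rounds and its game. In each round $t=1,\dots,T$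 all students simultaneously choose an action in $C\cup\{\emptyset\}$ (replacing any earlier application), after observing all actions in rounds $1,\dots,t-1$. Given the round-$t$ profile, each college holds its highest-priority eligible round-$t$ applicants up to capacity and rejects the others; this defines the tentative matching $\mu^t$. The final matching is $\mu^{TCDM(T)}=\mu^T$. A pure strategy assigns an action to each sequence of previous-round action profiles; students rank outcomes by their own final assignment according to $\succ_i$, and a profile is a Nash equilibrium if no student has a unilateral deviation yielding a strictly preferred final assignment. Preferences, scores, capacities, eligibility sets and $T$ are common knowledge. Straightforward strategy (with eligibility). In round 1 student $i$ chooses her $\succ_i$-best element of $\{c\in C:i\in A_c\}\cup\{\emptyset\}$. In round $t>1$: if $\mu^{t-1}(i)\in C$, she applies again to $\mu^{t-1}(i)$; if $\mu^{t-1}(i)=\emptyset$, she chooses her $\succ_i$-best element of $\{c\in C:i\in A_c,\ s_i\ge f_c(\mu^{t-1})\}\cup\{\emptyset\}$. Probabilities. For a fixed distribution over preference profiles $\succ=(\succ_i)_{i\in I}$ (everything else fixed), $p^{M}_{i,l}$ is the probability that mechanism $M$ (either $TCDM(T)$ under straightforward strategies or $DA$) assigns student $i$ to her $l$-th-ranked college among the colleges for which she is eligible (in particular $l=1$ is her most-preferred eligible college); the sums over $l\ge2$ run over ranks up to the number of her eligible colleges. *)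

theory Defs
  imports "HOL-Probability.Probability" "HOL-Library.While_Combinator"
begin

text \<open>
  The outside option is \<open>None\<close>, college \<open>c\<close> is \<open>Some c\<close>. Students and colleges range over finite
  carrier sets; profiles, action profiles and matchings are functions on the whole student type
  with a fixed default value outside the carrier, so that equality of functions is equality on
  the carrier.
\<close>

record ('i, 'c) admissions =
  students :: "'i set"
  colleges :: "'c set"
  capacity :: "'c \<Rightarrow> nat"
  score :: "'i \<Rightarrow> real"
  eligible :: "'c \<Rightarrow> 'i set"

type_synonym ('i, 'c) matching = "'i \<Rightarrow> 'c option"

type_synonym ('i, 'c) preferences = "'i \<Rightarrow> 'c option rel"

definition admissions_problem :: "('i, 'c) admissions \<Rightarrow> bool" where
  "admissions_problem M \<longleftrightarrow>
     finite (students M) \<and> finite (colleges M) \<and>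
     (\<forall>c\<in>colleges M. capacity M c > 0) \<and>
     (\<forall>i\<in>students M. score M i > 0) \<and> inj_on (score M) (students M) \<and>
     (\<forall>c\<in>colleges M. eligible M c \<subseteq> students M)"

definition priority :: "('i, 'c) admissions \<Rightarrow> 'i \<Rightarrow> 'i \<Rightarrow> bool" where
  "priority M i j \<longleftrightarrow> score M i > score M j"

definition options :: "('i, 'c) admissions \<Rightarrow> 'c option set" where
  "options M = insert None (Some ` colleges M)"

definition eligible_colleges :: "('i, 'c) admissions \<Rightarrow> 'i \<Rightarrow> 'c set" where
  "eligible_colleges M i = {c \<in> colleges M. i \<in> eligible M c}"

text \<open>\<open>(x, y) \<in> R i\<close> means that student \<open>i\<close> strictly prefers \<open>x\<close> to \<open>y\<close>.\<close>

definition preference_profiles :: "('i, 'c) admissions \<Rightarrow> ('i, 'c) preferences set" where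
  "preference_profiles M =
     {R. (\<forall>i\<in>students M. strict_linear_order_on (options M) (R i) \<and>
                          R i \<subseteq> options M \<times> options M) \<and>
         (\<forall>i. i \<notin> students M \<longrightarrow> R i = {})}"

definition best :: "'a rel \<Rightarrow> 'a set \<Rightarrow> 'a" where
  "best r X = (THE x. x \<in> X \<and> (\<forall>y\<in>X - {x}. (x, y) \<in> r))"


subsection \<open>Matchings and stability\<close>

definition assigned :: "('i, 'c) admissions \<Rightarrow> ('i, 'c) matching \<Rightarrow> 'c \<Rightarrow> 'i set" where
  "assigned M \<mu> c = {i \<in> students M. \<mu> i = Some c}"

definition is_matching :: "('i, 'c) admissions \<Rightarrow> ('i, 'c) matching \<Rightarrow> bool" where
  "is_matching M \<mu> \<longleftrightarrow>
     (\<forall>i\<in>students M. \<mu> i \<in> options M) \<and> (\<forall>i. i \<notin> students M \<longrightarrow> \<mu> i = None) \<and>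
     (\<forall>c\<in>colleges M. card (assigned M \<mu> c) \<le> capacity M c \<and> assigned M \<mu> c \<subseteq> eligible M c)"

definition student_blocks ::
  "('i, 'c) admissions \<Rightarrow> ('i, 'c) preferences \<Rightarrow> ('i, 'c) matching \<Rightarrow> 'i \<Rightarrow> bool" where
  "student_blocks M R \<mu> i \<longleftrightarrow> i \<in> students M \<and> (None, \<mu> i) \<in> R i"

definition pair_blocks ::
  "('i, 'c) admissions \<Rightarrow> ('i, 'c) preferences \<Rightarrow> ('i, 'c) matching \<Rightarrow> 'i \<Rightarrow> 'c \<Rightarrow> bool" where
  "pair_blocks M R \<mu> i c \<longleftrightarrow>
     i \<in> students M \<and> c \<in> colleges M \<and> i \<in> eligible M c \<and> (Some c, \<mu> i) \<in> R i \<and>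
     (card (assigned M \<mu> c) < capacity M c \<or> (\<exists>j\<in>assigned M \<mu> c. priority M i j))"

definition stable_matching ::
  "('i, 'c) admissions \<Rightarrow> ('i, 'c) preferences \<Rightarrow> ('i, 'c) matching \<Rightarrow> bool" where
  "stable_matching M R \<mu> \<longleftrightarrow>
     is_matching M \<mu> \<and> (\<forall>i. \<not> student_blocks M R \<mu> i) \<and> (\<forall>i c. \<not> pair_blocks M R \<mu> i c)"

definition cutoff :: "('i, 'c) admissions \<Rightarrow> ('i, 'c) matching \<Rightarrow> 'c \<Rightarrow> real" where
  "cutoff M \<mu> c =
     (if card (assigned M \<mu> c) = capacity M c then Min (score M ` assigned M \<mu> c) else 0)"


subsection \<open>Colleges' tentative choices\<close>

definition applicants :: "('i, 'c) admissions \<Rightarrow> ('i \<Rightarrow> 'c option) \<Rightarrow> 'c \<Rightarrow> 'i set" where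
  "applicants M a c = {i \<in> students M. i \<in> eligible M c \<and> a i = Some c}"

definition held :: "('i, 'c) admissions \<Rightarrow> ('i \<Rightarrow> 'c option) \<Rightarrow> 'c \<Rightarrow> 'i set" where
  "held M a c =
     {i \<in> applicants M a c. card {j \<in> applicants M a c. priority M j i} < capacity M c}"

definition hold :: "('i, 'c) admissions \<Rightarrow> ('i \<Rightarrow> 'c option) \<Rightarrow> ('i, 'c) matching" where
  "hold M a i = (if \<exists>c\<in>colleges M. i \<in> held M a c then a i else None)"


subsection \<open>Serial dictatorship and deferred acceptance\<close>

definition sd_step ::
  "('i, 'c) admissions \<Rightarrow> ('i, 'c) preferences \<Rightarrow> 'i \<Rightarrow> ('i, 'c) matching \<Rightarrow> ('i, 'c) matching" where
  "sd_step M R i \<mu> =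
     \<mu>(i := best (R i)
        (insert None (Some ` {c \<in> eligible_colleges M i. card (assigned M \<mu> c) < capacity M c})))"

definition serial_dictatorship ::
  "('i, 'c) admissions \<Rightarrow> ('i, 'c) preferences \<Rightarrow> ('i, 'c) matching" where
  "serial_dictatorship M R =
     fold (sd_step M R) (rev (sorted_key_list_of_set (score M) (students M))) (\<lambda>_. None)"

text \<open>
  The state of deferred acceptance is the set of pairs \<open>(i, c)\<close> such that \<open>c\<close> has already
  rejected \<open>i\<close>. Every student stands at her best option that has not rejected her, so a student
  who is tentatively held stays where she is. A student may propose to a college for which she
  is not eligible; she is then rejected.
\<close>

definition da_proposals ::
  "('i, 'c) admissions \<Rightarrow> ('i, 'c) preferences \<Rightarrow> ('i \<times> 'c) set \<Rightarrow> 'i \<Rightarrow> 'c option" where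
  "da_proposals M R J i =
     (if i \<in> students M then best (R i) (insert None (Some ` {c \<in> colleges M. (i, c) \<notin> J}))
      else None)"

definition da_rejections ::
  "('i, 'c) admissions \<Rightarrow> ('i, 'c) preferences \<Rightarrow> ('i \<times> 'c) set \<Rightarrow> ('i \<times> 'c) set" where
  "da_rejections M R J =
     {(i, c). da_proposals M R J i = Some c \<and> i \<notin> held M (da_proposals M R J) c}"

definition DA :: "('i, 'c) admissions \<Rightarrow> ('i, 'c) preferences \<Rightarrow> ('i, 'c) matching" where
  "DA M R =
     hold M (da_proposals M R
       (while (\<lambda>J. da_rejections M R J \<noteq> {}) (\<lambda>J. J \<union> da_rejections M R J) {}))"


subsection \<open>The time-constrained dynamic mechanism\<close>

text \<open>A history lists the action profiles of the previous rounds, in chronological order.\<close>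

type_synonym ('i, 'c) history = "('i \<Rightarrow> 'c option) list"

type_synonym ('i, 'c) strategy = "('i, 'c) history \<Rightarrow> 'c option"

definition action_profiles :: "('i, 'c) admissions \<Rightarrow> ('i \<Rightarrow> 'c option) set" where
  "action_profiles M =
     {a. (\<forall>i\<in>students M. a i \<in> options M) \<and> (\<forall>i. i \<notin> students M \<longrightarrow> a i = None)}"

definition is_strategy :: "('i, 'c) admissions \<Rightarrow> nat \<Rightarrow> ('i, 'c) strategy \<Rightarrow> bool" where
  "is_strategy M T \<tau> \<longleftrightarrow>
     (\<forall>h\<in>lists (action_profiles M). length h < T \<longrightarrow> \<tau> h \<in> options M)"

primrec play :: "('i, 'c) admissions \<Rightarrow> ('i \<Rightarrow> ('i, 'c) strategy) \<Rightarrow> nat \<Rightarrow> ('i, 'c) history" where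
  "play M \<sigma> 0 = []"
| "play M \<sigma> (Suc t) =
     play M \<sigma> t @ [\<lambda>i. if i \<in> students M then \<sigma> i (play M \<sigma> t) else None]"

text \<open>
  The matching \<open>\<mu>\<^sup>t\<close>, where \<open>\<mu>\<^sup>0\<close> is by convention the empty matching. It is also the final
  matching of the mechanism with \<open>T = t\<close> rounds.
\<close>

definition tentative ::
  "('i, 'c) admissions \<Rightarrow> ('i \<Rightarrow> ('i, 'c) strategy) \<Rightarrow> nat \<Rightarrow> ('i, 'c) matching" where
  "tentative M \<sigma> t = (if t = 0 then (\<lambda>_. None) else hold M (last (play M \<sigma> t)))"

definition nash_equilibrium ::
  "('i, 'c) admissions \<Rightarrow> ('i, 'c) preferences \<Rightarrow> nat \<Rightarrow> ('i \<Rightarrow> ('i, 'c) strategy) \<Rightarrow> bool" where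
  "nash_equilibrium M R T \<sigma> \<longleftrightarrow>
     (\<forall>i\<in>students M. is_strategy M T (\<sigma> i)) \<and>
     (\<forall>i\<in>students M. \<forall>\<tau>. is_strategy M T \<tau> \<longrightarrow>
        (tentative M (\<sigma>(i := \<tau>)) T i, tentative M \<sigma> T i) \<notin> R i)"

definition straightforward ::
  "('i, 'c) admissions \<Rightarrow> ('i, 'c) preferences \<Rightarrow> 'i \<Rightarrow> ('i, 'c) strategy" where
  "straightforward M R i h =
     (if h = [] then best (R i) (insert None (Some ` eligible_colleges M i))
      else let \<mu> = hold M (last h) in
        (case \<mu> i of
           Some c \<Rightarrow> Some c
         | None \<Rightarrow> best (R i)
             (insert None (Some ` {c \<in> eligible_colleges M i. score M i \<ge> cutoff M \<mu> c}))))"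

definition TCDM ::
  "('i, 'c) admissions \<Rightarrow> nat \<Rightarrow> ('i, 'c) preferences \<Rightarrow> ('i, 'c) matching" where
  "TCDM M T R = tentative M (straightforward M R) T"


subsection \<open>Assignment probabilities\<close>

definition eligible_rank ::
  "('i, 'c) admissions \<Rightarrow> ('i, 'c) preferences \<Rightarrow> 'i \<Rightarrow> 'c \<Rightarrow> nat" where
  "eligible_rank M R i c = Suc (card {d \<in> eligible_colleges M i. (Some d, Some c) \<in> R i})"

text \<open>
  A distribution over profiles is a \<open>pmf\<close> \<open>P\<close> with support in \<open>preference_profiles M\<close>; as that
  set is finite, this covers every distribution. The mechanism is passed as the function \<open>\<phi>\<close>
  from profiles to matchings.
\<close>

definition rank_prob ::
  "('i, 'c) admissions \<Rightarrow> ('i, 'c) preferences pmf \<Rightarrow>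
   (('i, 'c) preferences \<Rightarrow> ('i, 'c) matching) \<Rightarrow> 'i \<Rightarrow> nat \<Rightarrow> real" where
  "rank_prob M P \<phi> i l =
     measure_pmf.prob P
       {R. \<exists>c\<in>eligible_colleges M i. eligible_rank M R i c = l \<and> \<phi> R i = Some c}"

end

theory Submission
  imports Defs
begin

text \<open>Colleges share one priority order, so a college that is full of students ranked above \<open>i\<close>
  stays so: tentatively held students re-apply, and cutoffs only rise. By induction on rounds, the
  seat of a student in a stable matching \<open>\<mu>\<close> is never closed to her (the first higher-ranked
  student who takes it would form a blocking pair of \<open>\<mu>\<close>), hence she always applies to something
  at least as good as \<open>\<mu>\<close>. A student whose superiors have all settled at \<open>\<mu>\<close> finds everything
  better than her own stable seat closed, so one further round settles her. This gives convergence
  in as many rounds as there are students, and uniqueness, since every stable matching is the limit.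
  A deviation affects only lower-ranked students, whence the equilibrium. Finally, over time
  the number of assigned students grows while students only lose first choices.\<close>

section \<open>Rank cutoffs in finite sets\<close>

text \<open>A larger value of \<open>f\<close> leaves strictly fewer elements above it, so ranks are
  distinct; all lie below \<open>card A\<close>, and counting makes them exhaust
  \<open>{..<card A}\<close>.\<close>

lemma bij_betw_rank:
  fixes f :: "'a \<Rightarrow> 'b::linorder"
  assumes "finite A" "inj_on f A"
  shows "bij_betw (\<lambda>k. card {j\<in>A. f k < f j}) A {..<card A}"
proof -
  let ?r = "\<lambda>k. card {j\<in>A. f k < f j}"
  have less: "?r j < ?r i" if "i \<in> A" "j \<in> A" "f i < f j" for i j
  proof (rule psubset_card_mono)
    show "finite {k\<in>A. f i < f k}" using assms by simp
    show "{k\<in>A. f j < f k} \<subset> {k\<in>A. f i < f k}" using that by auto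
  qed
  have inj: "inj_on ?r A"
  proof (rule inj_onI)
    fix i j assume ij: "i \<in> A" "j \<in> A" "?r i = ?r j"
    then have "f i = f j"
      using less[of i j] less[of j i] by (metis less_irrefl linorder_neqE)
    then show "i = j" using ij assms by (auto dest: inj_onD)
  qed
  have "?r i < card A" if "i \<in> A" for i
    using that assms by (intro psubset_card_mono) auto
  then have "?r ` A \<subseteq> {..<card A}" by auto
  then have "?r ` A = {..<card A}"
    using inj by (intro card_subset_eq) (auto simp: card_image)
  then show ?thesis using inj by (simp add: bij_betw_def)
qed

lemma card_top:
  fixes f :: "'a \<Rightarrow> 'b::linorder"
  assumes "finite A" "inj_on f A"
  shows "card {i\<in>A. card {j\<in>A. f i < f j} < q} = min q (card A)"
proof -
  let ?r = "\<lambda>k. card {j\<in>A. f k < f j}"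
  have b: "bij_betw ?r A {..<card A}" using assms by (rule bij_betw_rank)
  have "bij_betw ?r {i\<in>A. ?r i < q} {..<min q (card A)}"
  proof (rule bij_betw_subset[OF b])
    have "?r ` {i\<in>A. ?r i < q} = ?r ` A \<inter> {..<q}" by auto
    also have "\<dots> = {..<min q (card A)}"
      unfolding bij_betw_imp_surj_on[OF b] by auto
    finally show "?r ` {i\<in>A. ?r i < q} = {..<min q (card A)}" .
  qed auto
  then show ?thesis by (auto dest: bij_betw_same_card)
qed

text \<open>Whoever outranks an element above \<open>x\<close> is also above \<open>x\<close>, so
  cutting \<open>A\<close> at \<open>x\<close> keeps the ranks of the survivors, and
  \<open>card_top\<close> applies to the cut set.\<close>

lemma card_top_above:
  fixes f :: "'a \<Rightarrow> 'b::linorder"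
  assumes "finite A" "inj_on f A"
  shows "card {k\<in>A. card {j\<in>A. f k < f j} < q \<and> x < f k} = min q (card {k\<in>A. x < f k})"
proof -
  let ?B = "{k\<in>A. x < f k}"
  have "{j\<in>?B. f k < f j} = {j\<in>A. f k < f j}" if "x < f k" for k
    using that by auto
  then have "{k\<in>A. card {j\<in>A. f k < f j} < q \<and> x < f k} = {k\<in>?B. card {j\<in>?B. f k < f j} < q}"
    by (auto cong: conj_cong)
  moreover have "card {k\<in>?B. card {j\<in>?B. f k < f j} < q} = min q (card ?B)"
    using assms by (intro card_top) (auto intro: inj_on_subset)
  ultimately show ?thesis by simp
qed


section \<open>Tentative matchings\<close>

text \<open>For a matching, \<open>full_above M \<mu> c i\<close> says that the score of \<open>i\<close> is below the cutoff of \<open>c\<close>.\<close>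

definition full_above :: "('i, 'c) admissions \<Rightarrow> ('i, 'c) matching \<Rightarrow> 'c \<Rightarrow> 'i \<Rightarrow> bool" where
  "full_above M \<mu> c i \<longleftrightarrow> capacity M c \<le> card {j \<in> assigned M \<mu> c. priority M j i}"

text \<open>Only students ranked above \<open>i\<close> enter the count. This locality is what makes
  inductions along the priority order work.\<close>

lemma full_above_cong:
  assumes "\<And>j. j \<in> students M \<Longrightarrow> priority M j i \<Longrightarrow> \<mu> j = \<nu> j"
  shows "full_above M \<mu> c i \<longleftrightarrow> full_above M \<nu> c i"
proof -
  have "{j \<in> assigned M \<mu> c. priority M j i} = {j \<in> assigned M \<nu> c. priority M j i}"
    using assms by (auto simp: assigned_def)
  then show ?thesis by (simp add: full_above_def)
qed

lemma priority_trans: "priority M i j \<Longrightarrow> priority M j k \<Longrightarrow> priority M i k"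
  by (simp add: priority_def)

lemma hold_cases: "hold M a i = None \<or> hold M a i = a i"
  by (simp add: hold_def)

lemma hold_eq_Some_iff: "hold M a i = Some c \<longleftrightarrow> c \<in> colleges M \<and> i \<in> held M a c"
  by (auto simp: hold_def held_def applicants_def)

lemma assigned_hold: "c \<in> colleges M \<Longrightarrow> assigned M (hold M a) c = held M a c"
  by (auto simp: assigned_def hold_eq_Some_iff) (auto simp: held_def applicants_def)

lemma hold_cong:
  assumes "a i = b i" "\<And>j. j \<in> students M \<Longrightarrow> priority M j i \<Longrightarrow> a j = b j"
  shows "hold M a i = hold M b i"
proof -
  have "{j \<in> applicants M a c. priority M j i} = {j \<in> applicants M b c. priority M j i}" for c
    using assms(2) by (auto simp: applicants_def)
  then have "i \<in> held M a c \<longleftrightarrow> i \<in> held M b c" for c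
    using assms(1) by (auto simp: held_def applicants_def)
  then show ?thesis using assms(1) by (simp add: hold_def)
qed

lemma is_matching_empty: "is_matching M (\<lambda>_. None)"
  by (simp add: is_matching_def options_def assigned_def)

section \<open>Fullness, cutoffs and priority induction in a fixed market\<close>

locale admissions_market =
  fixes M :: "('i, 'c) admissions"
  assumes problem: "admissions_problem M"
begin

lemma finite_students: "finite (students M)"
  and finite_colleges: "finite (colleges M)"
  and capacity_pos: "c \<in> colleges M \<Longrightarrow> capacity M c > 0"
  and inj_score: "inj_on (score M) (students M)"
  using problem by (auto simp: admissions_problem_def)

lemma finite_eligible_colleges: "finite (eligible_colleges M i)"
  using finite_colleges by (simp add: eligible_colleges_def)

lemma finite_assigned: "finite (assigned M \<mu> c)"
  using finite_students by (simp add: assigned_def)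

lemma finite_applicants: "finite (applicants M a c)"
  using finite_students by (simp add: applicants_def)

lemma inj_score_applicants: "inj_on (score M) (applicants M a c)"
  using inj_score by (rule inj_on_subset) (auto simp: applicants_def)

lemma priority_linear:
  "\<lbrakk>i \<in> students M; j \<in> students M; i \<noteq> j\<rbrakk> \<Longrightarrow> priority M i j \<or> priority M j i"
  using inj_score unfolding priority_def by (metis inj_onD linorder_neqE)

text \<open>Passing from \<open>i\<close> to a superior \<open>j\<close> shrinks the set of
  superiors, since \<open>j\<close> is a superior of \<open>i\<close> but not of itself.\<close>

lemma students_induct [consumes 1, case_names step]:
  assumes "i \<in> students M"
    and "\<And>i. i \<in> students M \<Longrightarrow> (\<And>j. j \<in> students M \<Longrightarrow> priority M j i \<Longrightarrow> P j) \<Longrightarrow> P i"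
  shows "P i"
  using assms(1)
proof (induction "card {j \<in> students M. priority M j i}" arbitrary: i rule: less_induct)
  case less
  have "card {k \<in> students M. priority M k j} < card {k \<in> students M. priority M k i}"
    if "j \<in> students M" "priority M j i" for j
    using that finite_students by (intro psubset_card_mono) (auto simp: priority_def)
  then show ?case using less assms(2) by blast
qed

lemma card_held: "card (held M a c) = min (capacity M c) (card (applicants M a c))"
  unfolding held_def priority_def
  by (rule card_top[OF finite_applicants inj_score_applicants])

text \<open>Rejected applicants may be counted as well: \<open>c\<close> keeps its top applicants,
  so its held superiors of \<open>i\<close> number the minimum of the capacity and the applying
  superiors, and this reaches the capacity exactly when the applying superiors do.\<close>

lemma full_above_hold_iff:
  assumes "c \<in> colleges M"
  shows "full_above M (hold M a) c i \<longleftrightarrow>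
    capacity M c \<le> card {j \<in> applicants M a c. priority M j i}"
proof -
  have "card {j \<in> held M a c. priority M j i}
      = min (capacity M c) (card {j \<in> applicants M a c. priority M j i})"
    using card_top_above[OF finite_applicants inj_score_applicants,
        of a c "capacity M c" "score M i"]
    by (simp add: held_def priority_def)
  then show ?thesis using assms by (simp add: full_above_def assigned_hold)
qed

lemma held_iff_not_full_above:
  assumes "c \<in> colleges M"
  shows "i \<in> held M a c \<longleftrightarrow> i \<in> applicants M a c \<and> \<not> full_above M (hold M a) c i"
  using assms by (auto simp: full_above_hold_iff held_def)

lemma hold_eq_Some:
  "hold M a i = Some c \<longleftrightarrow>
     i \<in> students M \<and> c \<in> eligible_colleges M i \<and> a i = Some c \<and> \<not> full_above M (hold M a) c i"
  by (auto simp: hold_eq_Some_iff held_iff_not_full_above applicants_def eligible_colleges_def)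

lemma is_matching_hold: "is_matching M (hold M a)"
  unfolding is_matching_def
proof (intro conjI ballI allI impI)
  fix i
  show "hold M a i \<in> options M"
    by (cases "hold M a i") (auto simp: options_def hold_eq_Some_iff)
  show "hold M a i = None" if "i \<notin> students M"
    using that by (cases "hold M a i") (auto simp: hold_eq_Some)
next
  fix c assume "c \<in> colleges M"
  then show "card (assigned M (hold M a) c) \<le> capacity M c"
    "assigned M (hold M a) c \<subseteq> eligible M c"
    by (auto simp: assigned_hold card_held) (auto simp: held_def applicants_def)
qed

lemma matching_eligible:
  "\<lbrakk>is_matching M \<mu>; \<mu> i = Some c\<rbrakk> \<Longrightarrow> i \<in> students M \<and> c \<in> eligible_colleges M i"
  by (fastforce simp: is_matching_def options_def assigned_def eligible_colleges_def)

text \<open>At a full college, missing the minimum score means that everyone assigned there is a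
  superior.\<close>

lemma cutoff_le_iff:
  assumes \<mu>: "is_matching M \<mu>" and c: "c \<in> colleges M" and i: "i \<in> students M"
  shows "cutoff M \<mu> c \<le> score M i \<longleftrightarrow> \<not> full_above M \<mu> c i"
proof -
  let ?A = "assigned M \<mu> c"
  have le: "card ?A \<le> capacity M c" using \<mu> c by (auto simp: is_matching_def)
  have sub: "card {j \<in> ?A. priority M j i} \<le> card ?A"
    using finite_assigned by (intro card_mono) auto
  show ?thesis
  proof (cases "card ?A = capacity M c")
    case True
    \<comment> \<open>Positive capacity makes the minimum in the cutoff range over a nonempty
      set.\<close>
    then have ne: "?A \<noteq> {}" using capacity_pos[OF c] by auto
    have "full_above M \<mu> c i \<longleftrightarrow> {j \<in> ?A. priority M j i} = ?A"
    proof
      assume "full_above M \<mu> c i"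
      then show "{j \<in> ?A. priority M j i} = ?A"
        using True sub finite_assigned by (intro card_subset_eq) (auto simp: full_above_def)
    qed (simp add: full_above_def True)
    also have "\<dots> \<longleftrightarrow> score M i < Min (score M ` ?A)"
      using ne finite_assigned by (auto simp: priority_def)
    finally show ?thesis using True by (simp add: cutoff_def not_less)
  next
    case False
    \<comment> \<open>Positive scores let every student pass the default cutoff 0 of a college with
      vacancies.\<close>
    moreover have "score M i > 0" using problem i by (auto simp: admissions_problem_def)
    ultimately show ?thesis using le sub by (auto simp: cutoff_def full_above_def)
  qed
qed

text \<open>The student \<open>i\<close> occupies one seat and does not outrank herself, so
  superiors fill at most the remaining ones.\<close>

lemma not_full_above_assigned:
  assumes \<mu>: "is_matching M \<mu>" and i: "\<mu> i = Some c"
  shows "\<not> full_above M \<mu> c i"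
proof -
  have ic: "i \<in> students M" "c \<in> colleges M"
    using matching_eligible[OF \<mu> i] by (auto simp: eligible_colleges_def)
  have "card {j \<in> assigned M \<mu> c. priority M j i} < card (assigned M \<mu> c)"
    using finite_assigned i ic
    by (intro psubset_card_mono) (auto simp: assigned_def priority_def)
  also have "\<dots> \<le> capacity M c" using \<mu> ic by (auto simp: is_matching_def)
  finally show ?thesis by (simp add: full_above_def)
qed

lemma not_full_above_empty: "c \<in> colleges M \<Longrightarrow> \<not> full_above M (\<lambda>_. None) c i"
  using capacity_pos by (simp add: full_above_def assigned_def)

lemma is_matching_tentative: "is_matching M (tentative M \<sigma> t)"
  by (simp add: tentative_def is_matching_empty is_matching_hold)

lemma tentative_Suc:
  "tentative M \<sigma> (Suc t) = hold M (\<lambda>j. if j \<in> students M then \<sigma> j (play M \<sigma> t) else None)"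
  by (simp add: tentative_def)

end


section \<open>Preferences and stability\<close>

locale admissions_profile = admissions_market M
  for M :: "('i, 'c) admissions" +
  fixes R :: "('i, 'c) preferences"
  assumes profile: "R \<in> preference_profiles M"
begin

text \<open>Off the carrier \<open>R i\<close> is empty, so these facts hold for every
  \<open>i\<close>.\<close>

lemma pref_trans: "\<lbrakk>(x, y) \<in> R i; (y, z) \<in> R i\<rbrakk> \<Longrightarrow> (x, z) \<in> R i"
  and pref_irrefl: "(x, x) \<notin> R i"
  and pref_students: "(x, y) \<in> R i \<Longrightarrow> i \<in> students M"
proof -
  have *: "trans (R i) \<and> irrefl (R i) \<and> (i \<notin> students M \<longrightarrow> R i = {})"
    using profile
    by (cases "i \<in> students M")
      (auto simp: preference_profiles_def strict_linear_order_on_def irrefl_def)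
  show "\<lbrakk>(x, y) \<in> R i; (y, z) \<in> R i\<rbrakk> \<Longrightarrow> (x, z) \<in> R i" using * by (meson transD)
  show "(x, x) \<notin> R i" using * by (meson irreflD)
  show "(x, y) \<in> R i \<Longrightarrow> i \<in> students M" using * by auto
qed

lemma pref_total:
  "\<lbrakk>i \<in> students M; x \<in> options M; y \<in> options M; x \<noteq> y\<rbrakk> \<Longrightarrow> (x, y) \<in> R i \<or> (y, x) \<in> R i"
  using profile by (auto simp: preference_profiles_def strict_linear_order_on_def total_on_def)

lemma Some_option: "c \<in> eligible_colleges M i \<Longrightarrow> Some c \<in> options M"
  and None_option: "None \<in> options M"
  by (auto simp: options_def eligible_colleges_def)

lemma matching_option: "is_matching M \<mu> \<Longrightarrow> \<mu> i \<in> options M"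
  by (cases "i \<in> students M") (auto simp: is_matching_def None_option)

lemma finite_option_set: "finite (options M)"
  using finite_colleges by (simp add: options_def)

lemma ex_best:
  assumes i: "i \<in> students M" and "X \<subseteq> options M" "X \<noteq> {}"
  shows "\<exists>x\<in>X. \<forall>y\<in>X - {x}. (x, y) \<in> R i"
proof -
  have "finite X" using assms(2) finite_option_set by (rule finite_subset)
  then show ?thesis
    using assms(3,2)
  proof (induction rule: finite_ne_induct)
    case (insert z F)
    then obtain x where x: "x \<in> F" "\<forall>y\<in>F - {x}. (x, y) \<in> R i" by auto
    consider "(x, z) \<in> R i" | "(z, x) \<in> R i"
      using pref_total[OF i, of x z] x insert by auto
    then show ?case
    proof cases
      case 1
      then show ?thesis using x by blast
    next
      case 2
      then have "\<forall>y\<in>insert z F - {z}. (z, y) \<in> R i"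
        using x pref_trans by blast
      then show ?thesis by blast
    qed
  qed auto
qed

text \<open>A maximum exists by finiteness and totality; transitivity and irreflexivity make it
  unique, so the description in \<open>best\<close> denotes it.\<close>

lemma
  assumes "i \<in> students M" "X \<subseteq> options M" "X \<noteq> {}"
  shows best_in: "best (R i) X \<in> X"
    and best_max: "y \<in> X \<Longrightarrow> (y, best (R i) X) \<notin> R i"
proof -
  obtain x where x: "x \<in> X" "\<forall>y\<in>X - {x}. (x, y) \<in> R i" using ex_best[OF assms] by blast
  have b: "best (R i) X = x"
    unfolding best_def
  proof (rule the_equality)
    fix x' assume "x' \<in> X \<and> (\<forall>y\<in>X - {x'}. (x', y) \<in> R i)"
    then show "x' = x" using x pref_trans pref_irrefl by blast
  qed (use x in blast)
  show "best (R i) X \<in> X" using b x by simp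
  show "(y, best (R i) X) \<notin> R i" if "y \<in> X"
    using that b x pref_trans pref_irrefl by blast
qed

text \<open>Not blocking with a desired college means that it has no vacancy and nobody below
  \<open>i\<close>; as scores are distinct, its seats are then all filled by superiors.\<close>

lemma stable_iff:
  "stable_matching M R \<mu> \<longleftrightarrow>
     is_matching M \<mu> \<and> (\<forall>i\<in>students M. (None, \<mu> i) \<notin> R i) \<and>
     (\<forall>i\<in>students M. \<forall>c\<in>eligible_colleges M i. (Some c, \<mu> i) \<in> R i \<longrightarrow> full_above M \<mu> c i)"
proof -
  have "pair_blocks M R \<mu> i c \<longleftrightarrow> i \<in> students M \<and> c \<in> eligible_colleges M i \<and>
      (Some c, \<mu> i) \<in> R i \<and> \<not> full_above M \<mu> c i" if \<mu>: "is_matching M \<mu>" for i c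
  proof (cases "i \<in> students M \<and> c \<in> eligible_colleges M i \<and> (Some c, \<mu> i) \<in> R i")
    case True
    let ?A = "assigned M \<mu> c" and ?H = "{j \<in> assigned M \<mu> c. priority M j i}"
    \<comment> \<open>Since \<open>i\<close> herself is not at \<open>c\<close>, distinct scores
      compare her strictly with everyone there.\<close>
    have "\<mu> i \<noteq> Some c" using True pref_irrefl by auto
    then have pr: "priority M j i \<longleftrightarrow> \<not> priority M i j" if "j \<in> ?A" for j
      using that True priority_linear[of i j] by (auto simp: assigned_def priority_def)
    have le: "card ?A \<le> capacity M c"
      using \<mu> True by (auto simp: is_matching_def eligible_colleges_def)
    have "full_above M \<mu> c i \<longleftrightarrow> card ?A = capacity M c \<and> (\<forall>j\<in>?A. priority M j i)"
    proof
      assume "full_above M \<mu> c i"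
      then have *: "capacity M c \<le> card ?H" by (simp add: full_above_def)
      moreover have "card ?H \<le> card ?A" using finite_assigned by (intro card_mono) auto
      ultimately have "?H = ?A" using le finite_assigned by (intro card_subset_eq) auto
      then show "card ?A = capacity M c \<and> (\<forall>j\<in>?A. priority M j i)" using * le by auto
    next
      assume *: "card ?A = capacity M c \<and> (\<forall>j\<in>?A. priority M j i)"
      then have "?H = ?A" by auto
      then show "full_above M \<mu> c i" using * by (simp add: full_above_def)
    qed
    then show ?thesis
      using True le pr by (auto simp: pair_blocks_def eligible_colleges_def)
  qed (auto simp: pair_blocks_def eligible_colleges_def)
  then show ?thesis
    by (auto simp: stable_matching_def student_blocks_def)
qed

lemma preferred_to_stable:
  assumes "stable_matching M R \<mu>" "(x, \<mu> i) \<in> R i"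
  obtains c where "x = Some c"
  using assms pref_students by (cases x) (auto simp: stable_iff)


subsection \<open>Serial dictatorship\<close>

text \<open>Serving one more student only enlarges the assigned sets, so colleges that were full
  above earlier students stay so. The newcomer ranks below all served before her, so a college
  without a vacancy is full of her superiors.\<close>

lemma sd_invariant:
  assumes "sorted_wrt (priority M) xs" "set xs \<subseteq> students M"
  defines "\<mu> \<equiv> fold (sd_step M R) xs (\<lambda>_. None)"
  shows "(\<forall>i. i \<notin> set xs \<longrightarrow> \<mu> i = None) \<and> is_matching M \<mu> \<and>
    (\<forall>i\<in>set xs. (None, \<mu> i) \<notin> R i \<and>
      (\<forall>c\<in>eligible_colleges M i. (Some c, \<mu> i) \<in> R i \<longrightarrow> full_above M \<mu> c i))"
  using assms(1,2) unfolding \<mu>_def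
proof (induction xs rule: rev_induct)
  case Nil
  then show ?case by (simp add: is_matching_empty)
next
  case (snoc x xs)
  define \<mu> where "\<mu> = fold (sd_step M R) xs (\<lambda>_. None)"
  define C where "C = {c \<in> eligible_colleges M x. card (assigned M \<mu> c) < capacity M c}"
  define b where "b = best (R x) (insert None (Some ` C))"
  have x: "x \<in> students M" using snoc.prems by auto
  have hi: "priority M i x" if "i \<in> set xs" for i
    using snoc.prems that by (auto simp: sorted_wrt_append)
  have inv: "(\<forall>i. i \<notin> set xs \<longrightarrow> \<mu> i = None) \<and> is_matching M \<mu> \<and>
    (\<forall>i\<in>set xs. (None, \<mu> i) \<notin> R i \<and>
      (\<forall>c\<in>eligible_colleges M i. (Some c, \<mu> i) \<in> R i \<longrightarrow> full_above M \<mu> c i))"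
    using snoc by (simp add: \<mu>_def sorted_wrt_append)
  then have xs: "i \<notin> set xs \<Longrightarrow> \<mu> i = None" and m: "is_matching M \<mu>" for i
    by auto
  \<comment> \<open>If \<open>x\<close> occurred in \<open>xs\<close>, she would outrank
    herself.\<close>
  have \<mu>x: "\<mu> x = None" using xs[of x] hi[of x] by (auto simp: priority_def)
  have opt: "insert None (Some ` C) \<subseteq> options M"
    by (auto simp: C_def None_option Some_option)
  have b_in: "b \<in> insert None (Some ` C)"
    unfolding b_def using x opt by (intro best_in) auto
  have b_max: "(y, b) \<notin> R x" if "y \<in> insert None (Some ` C)" for y
    unfolding b_def using x opt that by (intro best_max) auto
  define \<nu> where "\<nu> = fold (sd_step M R) (xs @ [x]) (\<lambda>_. None)"
  have "\<nu> = \<mu>(x := b)"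
    by (simp add: \<nu>_def \<mu>_def sd_step_def b_def C_def)
  then have \<nu>_eq: "\<nu> y = (if y = x then b else \<mu> y)" for y by simp
  have \<nu>_x: "\<nu> x = b" and \<nu>_xs: "y \<in> set xs \<Longrightarrow> \<nu> y = \<mu> y"
    and \<nu>_None: "y \<notin> set (xs @ [x]) \<Longrightarrow> \<nu> y = None" for y
    using hi[of x] xs[of y] by (auto simp: \<nu>_eq priority_def)
  have ass: "assigned M \<nu> c = (if b = Some c then insert x (assigned M \<mu> c) else assigned M \<mu> c)" for c
    using \<mu>x x by (auto simp: assigned_def \<nu>_eq)
  have fa: "full_above M \<nu> c i" if "full_above M \<mu> c i" for c i
    using that unfolding full_above_def
    by (rule order_trans) (intro card_mono; use finite_assigned in \<open>auto simp: ass\<close>)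
  have "is_matching M \<nu>"
    using m x b_in finite_assigned unfolding is_matching_def ass
    by (auto simp: \<nu>_eq C_def eligible_colleges_def options_def card_insert_if)
  moreover have "full_above M \<nu> c x"
    if c: "c \<in> eligible_colleges M x" "(Some c, b) \<in> R x" for c
  proof (rule fa)
    have "c \<notin> C" using c b_max by auto
    moreover have "{j \<in> assigned M \<mu> c. priority M j x} = assigned M \<mu> c"
      using hi xs by (force simp: assigned_def)
    ultimately show "full_above M \<mu> c x" using c by (auto simp: C_def full_above_def)
  qed
  ultimately show ?case
    unfolding \<nu>_def[symmetric] using inv fa b_max \<nu>_x \<nu>_xs \<nu>_None by auto
qed

lemma stable_serial_dictatorship: "stable_matching M R (serial_dictatorship M R)"
proof -
  \<comment> \<open>Distinct scores make \<open>score M\<close> an injective sort key, which yields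
    a strictly increasing list; reversed, it runs down the priority order.\<close>
  interpret score_order: folding_insort_key "(\<le>)" "(<)" "students M" "score M"
    rewrites "linorder.sorted_key_list_of_set (\<le>) = sorted_key_list_of_set"
    by unfold_locales (simp_all add: inj_score sorted_key_list_of_set_dict)
  let ?xs = "rev (sorted_key_list_of_set (score M) (students M))"
  have "sorted_wrt (<) (map (score M) (sorted_key_list_of_set (score M) (students M)))"
    by (rule score_order.strict_sorted_key_list_of_set) simp
  then have "sorted_wrt (priority M) ?xs"
    by (simp add: sorted_wrt_rev sorted_wrt_map priority_def)
  moreover have "set ?xs = students M"
    using score_order.set_sorted_key_list_of_set[of "students M"] finite_students by simp
  ultimately show ?thesis
    unfolding stable_iff serial_dictatorship_def using sd_invariant[of ?xs] by auto
qed


subsection \<open>Deferred acceptance\<close>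

text \<open>The exclusion argument shared by deferred acceptance and straightforward play: a
  superior of \<open>i\<close> applying to \<open>c\<close> from a different seat under
  \<open>\<mu>\<close> would block \<open>\<mu>\<close> with \<open>c\<close>, displacing
  \<open>i\<close>. So the applying superiors are all at \<open>c\<close> under
  \<open>\<mu>\<close>, where they leave \<open>i\<close> a seat.\<close>

lemma stable_not_full_above_of_attracted:
  assumes \<mu>: "stable_matching M R \<mu>" and i: "\<mu> i = Some c"
    and a: "\<And>j. j \<in> students M \<Longrightarrow> a j = Some c \<Longrightarrow> \<mu> j \<noteq> Some c \<Longrightarrow> (Some c, \<mu> j) \<in> R j"
  shows "\<not> full_above M (hold M a) c i"
proof
  have m: "is_matching M \<mu>" using \<mu> by (simp add: stable_iff)
  have c: "c \<in> colleges M" "i \<in> students M"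
    using matching_eligible[OF m i] by (auto simp: eligible_colleges_def)
  assume "full_above M (hold M a) c i"
  then have "capacity M c \<le> card {j \<in> applicants M a c. priority M j i}"
    using c by (simp add: full_above_hold_iff)
  also have "\<dots> \<le> card {j \<in> assigned M \<mu> c. priority M j i}"
  proof (rule card_mono)
    show "finite {j \<in> assigned M \<mu> c. priority M j i}" using finite_assigned by simp
    show "{j \<in> applicants M a c. priority M j i} \<subseteq> {j \<in> assigned M \<mu> c. priority M j i}"
    proof (rule ccontr)
      assume "\<not> ?thesis"
      then obtain j where j: "j \<in> students M" "j \<in> eligible M c" "a j = Some c"
        "priority M j i" "\<mu> j \<noteq> Some c"
        by (auto simp: applicants_def assigned_def)
      then have "(Some c, \<mu> j) \<in> R j" using a by blast
      then have "pair_blocks M R \<mu> j c"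
        using j c i by (auto simp: pair_blocks_def assigned_def)
      then show False using \<mu> by (simp add: stable_matching_def)
    qed
  qed
  finally have "full_above M \<mu> c i" by (simp add: full_above_def)
  then show False using not_full_above_assigned[OF m i] by simp
qed

text \<open>Her seat under \<open>\<mu>\<close> has not been crossed off, so the best remaining
  option is at least as good.\<close>

lemma da_proposals_weakly_preferred:
  assumes \<mu>: "stable_matching M R \<mu>" and J: "\<forall>(i, c)\<in>J. \<mu> i \<noteq> Some c"
    and i: "i \<in> students M"
  shows "da_proposals M R J i = \<mu> i \<or> (da_proposals M R J i, \<mu> i) \<in> R i"
proof -
  let ?X = "insert None (Some ` {c \<in> colleges M. (i, c) \<notin> J})"
  have m: "is_matching M \<mu>" using \<mu> by (simp add: stable_iff)
  have X: "?X \<subseteq> options M" by (auto simp: options_def)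
  have "\<mu> i \<in> ?X"
    using matching_option[OF m, of i] J by (fastforce simp: options_def)
  then have "(\<mu> i, best (R i) ?X) \<notin> R i"
    using i X by (intro best_max) auto
  moreover have "best (R i) ?X \<in> options M"
    using best_in[OF i X] X by blast
  ultimately have "best (R i) ?X = \<mu> i \<or> (best (R i) ?X, \<mu> i) \<in> R i"
    using pref_total[OF i _ matching_option[OF m, of i]] by blast
  then show ?thesis using i by (simp add: da_proposals_def)
qed

lemma da_rejections_not_stable:
  assumes \<mu>: "stable_matching M R \<mu>" and J: "\<forall>(i, c)\<in>J. \<mu> i \<noteq> Some c"
    and ic: "(i, c) \<in> da_rejections M R J"
  shows "\<mu> i \<noteq> Some c"
proof
  assume i: "\<mu> i = Some c"
  let ?a = "da_proposals M R J"
  have m: "is_matching M \<mu>" using \<mu> by (simp add: stable_iff)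
  have e: "i \<in> students M" "c \<in> colleges M" "i \<in> eligible M c"
    using matching_eligible[OF m i] by (auto simp: eligible_colleges_def)
  have "\<not> full_above M (hold M ?a) c i"
    using \<mu> i
  proof (rule stable_not_full_above_of_attracted)
    fix j assume "j \<in> students M" "?a j = Some c" "\<mu> j \<noteq> Some c"
    then show "(Some c, \<mu> j) \<in> R j"
      using da_proposals_weakly_preferred[OF \<mu> J, of j] by auto
  qed
  then have "i \<in> held M ?a c"
    using e ic by (auto simp: held_iff_not_full_above applicants_def da_rejections_def)
  then show False using ic by (simp add: da_rejections_def)
qed

text \<open>Loop invariant: no student has been rejected by her partner under \<open>\<mu>\<close>.
  The measure counts the pairs without a rejection. At exit every proposal is held, and induction
  along the priority order identifies it with \<open>\<mu>\<close>.\<close>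

lemma DA_eq_stable:
  assumes \<mu>: "stable_matching M R \<mu>"
  shows "DA M R = \<mu>"
  unfolding DA_def
proof (rule while_rule[where P = "\<lambda>J. \<forall>(i, c)\<in>J. \<mu> i \<noteq> Some c" and
      r = "Wellfounded.measure (\<lambda>J. card (students M \<times> colleges M - J))" and
      Q = "\<lambda>J. hold M (da_proposals M R J) = \<mu>"])
  have m: "is_matching M \<mu>" using \<mu> by (simp add: stable_iff)
  fix J assume J: "\<forall>(i, c)\<in>J. \<mu> i \<noteq> Some c"
  let ?a = "da_proposals M R J"
  show "\<forall>(i, c)\<in>J \<union> da_rejections M R J. \<mu> i \<noteq> Some c"
    using J da_rejections_not_stable[OF \<mu> J] by auto
  \<comment> \<open>Proposals avoid \<open>J\<close>, so each rejection is new and the measure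
    drops.\<close>
  have new: "i \<in> students M \<and> c \<in> colleges M \<and> (i, c) \<notin> J" if "?a i = Some c" for i c
  proof -
    let ?X = "insert None (Some ` {c \<in> colleges M. (i, c) \<notin> J})"
    have i: "i \<in> students M" using that by (auto simp: da_proposals_def split: if_splits)
    have "best (R i) ?X \<in> ?X" using i by (intro best_in) (auto simp: options_def)
    then show ?thesis using that i by (auto simp: da_proposals_def)
  qed
  show "(J \<union> da_rejections M R J, J) \<in> Wellfounded.measure (\<lambda>J. card (students M \<times> colleges M - J))"
    if "da_rejections M R J \<noteq> {}"
  proof -
    obtain i c where ic: "(i, c) \<in> da_rejections M R J" using \<open>da_rejections M R J \<noteq> {}\<close> by auto
    then have "(i, c) \<in> students M \<times> colleges M - J"
      using new by (auto simp: da_rejections_def)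
    then have "students M \<times> colleges M - (J \<union> da_rejections M R J) \<subset> students M \<times> colleges M - J"
      using ic by blast
    then show ?thesis
      using finite_students finite_colleges by (simp add: psubset_card_mono)
  qed
  show "hold M ?a = \<mu>" if "\<not> da_rejections M R J \<noteq> {}"
  proof
    have h: "i \<in> held M ?a c" if "?a i = Some c" for i c
      using that \<open>\<not> da_rejections M R J \<noteq> {}\<close> by (auto simp: da_rejections_def)
    have hold: "hold M ?a i = ?a i" for i
      using h[of i] new[of i] hold_cases[of M ?a i]
      by (cases "?a i") (auto simp: hold_eq_Some_iff)
    fix i
    show "hold M ?a i = \<mu> i"
    proof (cases "i \<in> students M")
      case True
      then show ?thesis
      proof (induction i rule: students_induct)
        case (step i)
        show ?case
        proof (rule ccontr)
          assume "\<not> ?case"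
          then have pref: "(?a i, \<mu> i) \<in> R i"
            using da_proposals_weakly_preferred[OF \<mu> J, of i] step hold by auto
          then obtain c where c: "?a i = Some c" by (rule preferred_to_stable[OF \<mu>])
          have "c \<in> eligible_colleges M i" and nf: "\<not> full_above M (hold M ?a) c i"
            using hold[of i] c by (auto simp: hold_eq_Some)
          then have "full_above M \<mu> c i" using \<mu> pref c step by (auto simp: stable_iff)
          \<comment> \<open>By the induction hypothesis both matchings agree on the superiors of
            \<open>i\<close>.\<close>
          moreover have "full_above M \<mu> c i \<longleftrightarrow> full_above M (hold M ?a) c i"
            by (rule full_above_cong) (use step in auto)
          ultimately show False using nf by simp
        qed
      qed
    next
      case False
      then have "hold M ?a i = None" "\<mu> i = None"
        using is_matching_hold[of ?a] m by (auto simp: is_matching_def)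
      then show ?thesis by simp
    qed
  qed
qed auto


end


section \<open>Straightforward play\<close>

text \<open>The strategy depends on the history only through the last tentative matching. This is
  that dependence, with cutoffs expressed by \<open>full_above\<close> and \<open>None\<close> as
  default off the carrier.\<close>

definition straightforward_action ::
  "('i, 'c) admissions \<Rightarrow> ('i, 'c) preferences \<Rightarrow> ('i, 'c) matching \<Rightarrow> 'i \<Rightarrow> 'c option" where
  "straightforward_action M R \<mu> i =
     (if i \<in> students M then
        (case \<mu> i of Some c \<Rightarrow> Some c
         | None \<Rightarrow> best (R i)
             (insert None (Some ` {c \<in> eligible_colleges M i. \<not> full_above M \<mu> c i})))
      else None)"

context admissions_profile
begin

lemma straightforward_action_cong:
  assumes "\<mu> i = \<nu> i" "\<And>j. j \<in> students M \<Longrightarrow> priority M j i \<Longrightarrow> \<mu> j = \<nu> j"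
  shows "straightforward_action M R \<mu> i = straightforward_action M R \<nu> i"
  using assms full_above_cong[of M i \<mu> \<nu>] by (simp add: straightforward_action_def split: option.split)

text \<open>The opening rule is the general one at the empty matching, where positive capacities
  leave every college open. The profile \<open>\<sigma>\<close> is arbitrary so that histories after
  a deviation are covered.\<close>

lemma straightforward_eq_action:
  assumes i: "i \<in> students M"
  shows "straightforward M R i (play M \<sigma> t) = straightforward_action M R (tentative M \<sigma> t) i"
proof (cases t)
  case 0
  have "{c \<in> eligible_colleges M i. \<not> full_above M (\<lambda>_. None) c i} = eligible_colleges M i"
    using not_full_above_empty by (auto simp: eligible_colleges_def)
  then show ?thesis
    using i 0 by (simp add: straightforward_def straightforward_action_def tentative_def)
next
  case (Suc n)
  define \<mu> where "\<mu> = tentative M \<sigma> t"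
  have "is_matching M \<mu>" unfolding \<mu>_def by (rule is_matching_tentative)
  then have "{c \<in> eligible_colleges M i. cutoff M \<mu> c \<le> score M i}
      = {c \<in> eligible_colleges M i. \<not> full_above M \<mu> c i}"
    using i by (auto simp: cutoff_le_iff eligible_colleges_def)
  moreover have "hold M (last (play M \<sigma> t)) = \<mu>" using Suc by (simp add: \<mu>_def tentative_def)
  moreover have "play M \<sigma> t \<noteq> []" using Suc by simp
  ultimately show ?thesis
    using i unfolding \<mu>_def[symmetric]
    by (simp add: straightforward_def straightforward_action_def Let_def split: option.split)
qed

section \<open>The path of tentative matchings under straightforward strategies\<close>

abbreviation \<mu>SF :: "nat \<Rightarrow> ('i, 'c) matching" where
  "\<mu>SF \<equiv> tentative M (straightforward M R)"

abbreviation act :: "nat \<Rightarrow> ('i, 'c) matching" where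
  "act t \<equiv> straightforward_action M R (\<mu>SF t)"

lemma \<mu>SF_0: "\<mu>SF 0 = (\<lambda>_. None)"
  by (simp add: tentative_def)

lemma \<mu>SF_Suc: "\<mu>SF (Suc t) = hold M (act t)"
proof -
  have "(\<lambda>j. if j \<in> students M then straightforward M R j (play M (straightforward M R) t) else None)
      = act t"
    by (rule ext) (simp add: straightforward_eq_action, simp add: straightforward_action_def)
  then show ?thesis by (simp add: tentative_Suc)
qed

lemma act_held: "\<mu>SF t i = Some c \<Longrightarrow> act t i = Some c"
  using matching_eligible[OF is_matching_tentative] by (fastforce simp: straightforward_action_def)

lemma act_None:
  assumes "i \<in> students M" "\<mu>SF t i = None"
  defines "X \<equiv> insert None (Some ` {c \<in> eligible_colleges M i. \<not> full_above M (\<mu>SF t) c i})"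
  shows "act t i \<in> X" and "y \<in> X \<Longrightarrow> (y, act t i) \<notin> R i"
proof -
  have X: "X \<subseteq> options M" "X \<noteq> {}" by (auto simp: X_def None_option Some_option)
  have "act t i = best (R i) X" using assms(1,2) by (simp add: straightforward_action_def X_def)
  then show "act t i \<in> X" "y \<in> X \<Longrightarrow> (y, act t i) \<notin> R i"
    using best_in[OF assms(1) X] best_max[OF assms(1) X] by auto
qed

text \<open>An unassigned student chooses among open colleges only; a held one re-applies to her own
  seat, which \<open>not_full_above_assigned\<close> shows to be open to her.\<close>

lemma act_eq_Some:
  assumes "act t i = Some c"
  shows "i \<in> students M \<and> c \<in> eligible_colleges M i \<and> \<not> full_above M (\<mu>SF t) c i"
proof -
  have i: "i \<in> students M" using assms by (auto simp: straightforward_action_def split: if_splits)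
  show ?thesis
  proof (cases "\<mu>SF t i")
    case None
    then show ?thesis using act_None(1)[OF i None] assms i by auto
  next
    case (Some d)
    then have "\<mu>SF t i = Some c" using act_held assms by fastforce
    then show ?thesis
      using matching_eligible[OF is_matching_tentative]
        not_full_above_assigned[OF is_matching_tentative] by blast
  qed
qed

lemma act_option: "act t i \<in> options M"
  using act_eq_Some[of t i] by (cases "act t i") (auto simp: None_option Some_option)

lemma \<mu>SF_Suc_eq_Some:
  "\<mu>SF (Suc t) i = Some c \<longleftrightarrow> act t i = Some c \<and> \<not> full_above M (\<mu>SF (Suc t)) c i"
  using act_eq_Some[of t i c] by (auto simp: \<mu>SF_Suc hold_eq_Some)

lemma assigned_subset_applicants:
  "c \<in> colleges M \<Longrightarrow> assigned M (\<mu>SF t) c \<subseteq> applicants M (act t) c"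
  using is_matching_tentative[of "straightforward M R" t] act_held
  by (auto simp: applicants_def assigned_def is_matching_def)

text \<open>The superiors filling \<open>c\<close> all re-apply there, and new applicants can only
  add to them.\<close>

lemma full_above_mono:
  assumes c: "c \<in> colleges M" and f: "full_above M (\<mu>SF t) c i"
  shows "full_above M (\<mu>SF (Suc t)) c i"
proof -
  have "capacity M c \<le> card {j \<in> assigned M (\<mu>SF t) c. priority M j i}"
    using f by (simp add: full_above_def)
  also have "\<dots> \<le> card {j \<in> applicants M (act t) c. priority M j i}"
    using finite_applicants assigned_subset_applicants[OF c] by (intro card_mono) auto
  finally show ?thesis using c by (simp add: \<mu>SF_Suc full_above_hold_iff)
qed

lemma card_assigned_mono:
  assumes c: "c \<in> colleges M"
  shows "card (assigned M (\<mu>SF t) c) \<le> card (assigned M (\<mu>SF (Suc t)) c)"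
proof -
  have "card (assigned M (\<mu>SF t) c) \<le> capacity M c"
    using is_matching_tentative[of "straightforward M R" t] c by (simp add: is_matching_def)
  moreover have "card (assigned M (\<mu>SF t) c) \<le> card (applicants M (act t) c)"
    using finite_applicants assigned_subset_applicants[OF c] by (intro card_mono)
  ultimately show ?thesis using c by (simp add: \<mu>SF_Suc assigned_hold card_held)
qed

text \<open>A held student re-applies, so her action was chosen in some earlier round; since cutoffs
  only rise, every college open to her now was open to her then.\<close>

lemma act_best:
  assumes i: "i \<in> students M"
  shows act_best_None: "(None, act t i) \<notin> R i"
    and act_best_open:
      "\<lbrakk>c \<in> eligible_colleges M i; \<not> full_above M (\<mu>SF t) c i\<rbrakk> \<Longrightarrow> (Some c, act t i) \<notin> R i"
proof -
  have "(None, act t i) \<notin> R i \<and>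
    (\<forall>c\<in>eligible_colleges M i. \<not> full_above M (\<mu>SF t) c i \<longrightarrow> (Some c, act t i) \<notin> R i)"
  proof (induction t)
    case 0
    then show ?case using act_None(2)[OF i, of 0] by (simp add: \<mu>SF_0)
  next
    case (Suc t)
    show ?case
    proof (cases "\<mu>SF (Suc t) i")
      case None
      then show ?thesis using act_None(2)[OF i None] by auto
    next
      case (Some d)
      then have "act (Suc t) i = act t i" using act_held by (simp add: \<mu>SF_Suc_eq_Some)
      then show ?thesis using Suc full_above_mono by (auto simp: eligible_colleges_def)
    qed
  qed
  then show "(None, act t i) \<notin> R i"
    "\<lbrakk>c \<in> eligible_colleges M i; \<not> full_above M (\<mu>SF t) c i\<rbrakk> \<Longrightarrow> (Some c, act t i) \<notin> R i"
    by auto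
qed


subsection \<open>Comparison with a stable matching\<close>

text \<open>The induction covers all students at once: the hypothesis is needed for the rival
  applicants \<open>j\<close> to \<open>c\<close>, not for \<open>i\<close>.\<close>

lemma stable_college_open:
  assumes \<mu>: "stable_matching M R \<mu>" and i: "\<mu> i = Some c"
  shows "\<not> full_above M (\<mu>SF t) c i"
  using i
proof (induction t arbitrary: i c)
  case 0
  then have "c \<in> eligible_colleges M i" using \<mu> matching_eligible by (auto simp: stable_iff)
  then show ?case by (simp add: \<mu>SF_0 not_full_above_empty eligible_colleges_def)
next
  case (Suc t)
  have m: "is_matching M \<mu>" using \<mu> by (simp add: stable_iff)
  show ?case
    unfolding \<mu>SF_Suc using \<mu> Suc.prems
  proof (rule stable_not_full_above_of_attracted)
    fix j assume j: "j \<in> students M" "act t j = Some c" "\<mu> j \<noteq> Some c"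
    \<comment> \<open>The stable seat of \<open>j\<close> was open to her in the previous round, so
      applying to \<open>c\<close> instead reveals that she prefers \<open>c\<close>.\<close>
    have "(\<mu> j, act t j) \<notin> R j"
      using Suc.IH[of j] act_best[OF j(1)] matching_eligible[OF m] by (cases "\<mu> j") auto
    then show "(Some c, \<mu> j) \<in> R j"
      using pref_total[OF j(1), of "\<mu> j" "act t j"] act_option[of t j] matching_option[OF m] j
      by auto
  qed
qed

lemma act_weakly_preferred:
  assumes \<mu>: "stable_matching M R \<mu>" and i: "i \<in> students M"
  shows "act t i = \<mu> i \<or> (act t i, \<mu> i) \<in> R i"
proof -
  have m: "is_matching M \<mu>" using \<mu> by (simp add: stable_iff)
  have "(\<mu> i, act t i) \<notin> R i"
    using stable_college_open[OF \<mu>, of i] act_best[OF i] matching_eligible[OF m]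
    by (cases "\<mu> i") auto
  then show ?thesis
    using pref_total[OF i act_option[of t i] matching_option[OF m, of i]] by blast
qed

lemma act_stable_imp_held:
  assumes \<mu>: "stable_matching M R \<mu>" and a: "act t i = \<mu> i"
  shows "\<mu>SF (Suc t) i = \<mu> i"
proof (cases "\<mu> i")
  case None
  then show ?thesis using a hold_cases[of M "act t" i] by (auto simp: \<mu>SF_Suc)
next
  case (Some c)
  then show ?thesis using a stable_college_open[OF \<mu> Some] by (simp add: \<mu>SF_Suc_eq_Some)
qed

text \<open>A student with \<open>k\<close> superiors is settled from round \<open>k + 1\<close> on.
  Once they all sit at their stable seats, any college better than \<open>\<mu> i\<close> is full
  above \<open>i\<close>, and she never applies to such a college.\<close>

lemma converged:
  assumes \<mu>: "stable_matching M R \<mu>" and "i \<in> students M"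
    and "card {j \<in> students M. priority M j i} \<le> t"
  shows "\<mu>SF (Suc t) i = \<mu> i"
  using assms(2,3)
proof (induction i arbitrary: t rule: students_induct)
  case (step i)
  have higher: "\<mu>SF t j = \<mu> j" if j: "j \<in> students M" "priority M j i" for j
  proof -
    have "card {k \<in> students M. priority M k j} < card {k \<in> students M. priority M k i}"
      using j finite_students by (intro psubset_card_mono) (auto simp: priority_def)
    \<comment> \<open>A superior \<open>j\<close> has strictly fewer superiors than
      \<open>i\<close>, so she is settled one round earlier.\<close>
    then obtain s where "t = Suc s" "card {k \<in> students M. priority M k j} \<le> s"
      using step.prems by (cases t) auto
    then show ?thesis using step.IH j by blast
  qed
  have "act t i = \<mu> i"
  proof (rule ccontr)
    assume "act t i \<noteq> \<mu> i"
    then have pref: "(act t i, \<mu> i) \<in> R i" using act_weakly_preferred[OF \<mu> step.hyps] by auto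
    then obtain c where c: "act t i = Some c" by (rule preferred_to_stable[OF \<mu>])
    have "full_above M \<mu> c i"
      using \<mu> pref c act_eq_Some[OF c] by (auto simp: stable_iff)
    then have "full_above M (\<mu>SF t) c i"
      using full_above_cong[of M i "\<mu>SF t" \<mu>] higher by simp
    then show False using act_eq_Some[OF c] by simp
  qed
  then show ?case by (rule act_stable_imp_held[OF \<mu>])
qed

lemma tentative_eq_stable:
  assumes \<mu>: "stable_matching M R \<mu>" and t: "card (students M) \<le> t"
  shows "\<mu>SF t = \<mu>"
proof
  fix i
  have m: "is_matching M \<mu>" using \<mu> by (simp add: stable_iff)
  show "\<mu>SF t i = \<mu> i"
  proof (cases "i \<in> students M")
    case True
    \<comment> \<open>Not being her own superior saves \<open>i\<close> the one round that
      \<open>Suc\<close> costs in \<open>converged\<close>.\<close>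
    then have "card {j \<in> students M. priority M j i} < card (students M)"
      using finite_students by (intro psubset_card_mono) (auto simp: priority_def)
    then obtain s where "t = Suc s" "card {j \<in> students M. priority M j i} \<le> s"
      using t by (cases t) auto
    then show ?thesis using converged[OF \<mu> True] by blast
  next
    case False
    then show ?thesis
      using m is_matching_tentative[of "straightforward M R" t] by (simp add: is_matching_def)
  qed
qed

text \<open>Every stable matching equals the tentative matching after
  \<open>card (students M)\<close> rounds, which is defined without reference to it.\<close>

lemma stable_unique: "stable_matching M R \<mu> \<Longrightarrow> \<mu> = serial_dictatorship M R"
  using tentative_eq_stable stable_serial_dictatorship by (metis order_refl)

lemma DA_stable: "stable_matching M R (DA M R)"
  using DA_eq_stable[OF stable_serial_dictatorship] stable_serial_dictatorship by simp

text \<open>The college \<open>c\<close> gained by \<open>i\<close> is full of her superiors under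
  \<open>\<mu>\<close> but not now, so some superior \<open>j\<close> is missing from it. Either
  \<open>j\<close> is unassigned, or she too sits strictly better than under \<open>\<mu>\<close>
  and the argument repeats further up.\<close>

lemma unassigned_above_of_preferred:
  assumes \<mu>: "stable_matching M R \<mu>" and "i \<in> students M" "(\<mu>SF (Suc t) i, \<mu> i) \<in> R i"
  shows "\<exists>j\<in>students M. priority M j i \<and> \<mu>SF (Suc t) j = None"
  using assms(2,3)
proof (induction i rule: students_induct)
  case (step i)
  obtain c where c: "\<mu>SF (Suc t) i = Some c"
    using step.prems by (rule preferred_to_stable[OF \<mu>])
  then have e: "c \<in> eligible_colleges M i" "\<not> full_above M (\<mu>SF (Suc t)) c i"
    using act_eq_Some[of t i c] by (auto simp: \<mu>SF_Suc_eq_Some)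
  moreover have "full_above M \<mu> c i" using \<mu> step e c by (auto simp: stable_iff)
  ultimately have "\<not> {j \<in> assigned M \<mu> c. priority M j i}
      \<subseteq> {j \<in> assigned M (\<mu>SF (Suc t)) c. priority M j i}"
    using card_mono[of "{j \<in> assigned M (\<mu>SF (Suc t)) c. priority M j i}"
        "{j \<in> assigned M \<mu> c. priority M j i}"] finite_assigned
    by (force simp: full_above_def)
  then obtain j where j: "j \<in> students M" "\<mu> j = Some c" "priority M j i" "\<mu>SF (Suc t) j \<noteq> Some c"
    by (auto simp: assigned_def)
  show ?case
  proof (cases "\<mu>SF (Suc t) j")
    case None
    then show ?thesis using j by blast
  next
    case (Some d)
    \<comment> \<open>Her current seat is the one she applied to, hence at least as good as
      \<open>\<mu> j\<close>, and it differs from \<open>\<mu> j\<close>.\<close>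
    then have "(\<mu>SF (Suc t) j, \<mu> j) \<in> R j"
      using act_weakly_preferred[OF \<mu> j(1), of t] j by (metis \<mu>SF_Suc_eq_Some)
    then obtain k where k: "k \<in> students M" "priority M k j" "\<mu>SF (Suc t) k = None"
      using step.IH[OF j(1,3)] by blast
    then show ?thesis using priority_trans[OF k(2) j(3)] by blast
  qed
qed


subsection \<open>Equilibrium\<close>

lemma is_strategy_straightforward:
  assumes i: "i \<in> students M"
  shows "is_strategy M T (straightforward M R i)"
  unfolding is_strategy_def
proof (intro ballI impI)
  fix h assume "h \<in> lists (action_profiles M)" "length h < T"
  have best: "best (R i) (insert None (Some ` C)) \<in> options M" if "C \<subseteq> eligible_colleges M i" for C
  proof -
    have "insert None (Some ` C) \<subseteq> options M"
      using that Some_option None_option by blast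
    then show ?thesis using best_in[OF i] by blast
  qed
  show "straightforward M R i h \<in> options M"
  proof (cases "h = []")
    case True
    then show ?thesis by (simp add: straightforward_def best)
  next
    case False
    then show ?thesis
      using matching_option[OF is_matching_hold, of "last h" i]
      by (auto simp: straightforward_def Let_def best split: option.split)
  qed
qed

text \<open>Actions and holding at \<open>j\<close> depend only on \<open>j\<close> and her
  superiors, who all rank above the deviator \<open>i\<close>; so a change at \<open>i\<close> never
  travels upwards.\<close>

lemma deviation_above:
  assumes "j \<in> students M" "priority M j i"
  shows "tentative M ((straightforward M R)(i := \<tau>)) t j = \<mu>SF t j"
  using assms
proof (induction t arbitrary: j)
  case 0
  then show ?case by (simp add: tentative_def)
next
  case (Suc t)
  let ?\<sigma> = "(straightforward M R)(i := \<tau>)"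
  let ?a = "\<lambda>j. if j \<in> students M then ?\<sigma> j (play M ?\<sigma> t) else None"
  have a: "?a k = act t k" if k: "k \<in> students M" "priority M k i" for k
  proof -
    have "k \<noteq> i" using k by (auto simp: priority_def)
    then have "?a k = straightforward_action M R (tentative M ?\<sigma> t) k"
      using k by (simp add: straightforward_eq_action)
    also have "\<dots> = act t k"
    proof (rule straightforward_action_cong)
      show "tentative M ?\<sigma> t k = \<mu>SF t k" using k by (rule Suc.IH)
      show "tentative M ?\<sigma> t l = \<mu>SF t l" if "l \<in> students M" "priority M l k" for l
        using that(1) priority_trans[OF that(2) k(2)] by (rule Suc.IH)
    qed
    finally show ?thesis .
  qed
  have "hold M ?a j = hold M (act t) j"
  proof (rule hold_cong)
    show "?a j = act t j" using Suc.prems by (rule a)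
    show "?a k = act t k" if "k \<in> students M" "priority M k j" for k
      using that(1) priority_trans[OF that(2) Suc.prems(2)] by (rule a)
  qed
  then show ?case unfolding \<mu>SF_Suc tentative_Suc[of ?\<sigma>] .
qed

text \<open>A college better than \<open>\<mu> i\<close> is full of superiors of \<open>i\<close>,
  whose final seats her deviation leaves unchanged, so she cannot hold a seat there.\<close>

lemma nash_equilibrium_straightforward:
  assumes T: "card (students M) \<le> T"
  shows "nash_equilibrium M R T (straightforward M R)"
  unfolding nash_equilibrium_def
proof (intro conjI ballI allI impI)
  fix i \<tau> assume i: "i \<in> students M"
  show "is_strategy M T (straightforward M R i)" using i by (rule is_strategy_straightforward)
  define \<mu> where "\<mu> = serial_dictatorship M R"
  have \<mu>: "stable_matching M R \<mu>" unfolding \<mu>_def by (rule stable_serial_dictatorship)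
  have eq: "\<mu>SF T = \<mu>" using \<mu> T by (rule tentative_eq_stable)
  define \<nu> where "\<nu> = tentative M ((straightforward M R)(i := \<tau>)) T"
  have m: "is_matching M \<nu>" unfolding \<nu>_def by (rule is_matching_tentative)
  show "(\<nu> i, \<mu>SF T i) \<notin> R i"
  proof
    assume pref: "(\<nu> i, \<mu>SF T i) \<in> R i"
    then have "(\<nu> i, \<mu> i) \<in> R i" by (simp add: eq)
    then obtain c where c: "\<nu> i = Some c" by (rule preferred_to_stable[OF \<mu>])
    have "full_above M \<mu> c i"
      using \<mu> pref c i matching_eligible[OF m c] by (auto simp: stable_iff eq)
    moreover have "full_above M \<nu> c i \<longleftrightarrow> full_above M \<mu> c i"
      using deviation_above[of _ i \<tau> T] by (intro full_above_cong) (simp add: \<nu>_def eq)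
    ultimately show False using not_full_above_assigned[OF m c] by simp
  qed
qed


subsection \<open>Top choices\<close>

lemma eligible_rank_eq_1:
  "eligible_rank M R i c = 1 \<longleftrightarrow> (\<forall>d\<in>eligible_colleges M i. (Some d, Some c) \<notin> R i)"
  using finite_eligible_colleges by (auto simp: eligible_rank_def)

text \<open>No college beats itself. The bound shows that the upper limit of the rank sums cuts off
  no assignment.\<close>

lemma eligible_rank_le:
  assumes "c \<in> eligible_colleges M i"
  shows "eligible_rank M R i c \<le> card (eligible_colleges M i)"
proof -
  have "card {d \<in> eligible_colleges M i. (Some d, Some c) \<in> R i} < card (eligible_colleges M i)"
    using assms pref_irrefl finite_eligible_colleges by (intro psubset_card_mono) auto
  then show ?thesis by (simp add: eligible_rank_def)
qed

text \<open>Her action cannot be worse than an open college, and nothing she could apply to, nor the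
  outside option, beats \<open>c\<close>.\<close>

lemma act_top:
  assumes c: "c \<in> eligible_colleges M i" and top: "eligible_rank M R i c = 1"
    and i: "i \<in> students M" and None: "(None, Some c) \<notin> R i"
    and "\<not> full_above M (\<mu>SF t) c i"
  shows "act t i = Some c"
proof (rule ccontr)
  assume "act t i \<noteq> Some c"
  moreover have "(Some c, act t i) \<notin> R i" using act_best_open[OF i c] assms by blast
  ultimately have "(act t i, Some c) \<in> R i"
    using pref_total[OF i, of "act t i" "Some c"] act_option Some_option[OF c] by auto
  then show False
    using top None act_eq_Some[of t i] unfolding eligible_rank_eq_1 by (cases "act t i") auto
qed

lemma top_stable_imp_top_TCDM:
  assumes \<mu>: "stable_matching M R \<mu>" and i: "\<mu> i = Some c" and top: "eligible_rank M R i c = 1"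
  shows "\<mu>SF (Suc t) i = Some c"
proof -
  have e: "i \<in> students M" "c \<in> eligible_colleges M i"
    using \<mu> matching_eligible i by (auto simp: stable_iff)
  have "(None, Some c) \<notin> R i" using \<mu> e i by (auto simp: stable_iff)
  then have "act t i = Some c"
    using e top stable_college_open[OF \<mu> i] by (intro act_top)
  then show ?thesis using act_stable_imp_held[OF \<mu>] i by simp
qed

text \<open>Openness passes backwards in time: \<open>c\<close> was open to her after rounds
  \<open>t\<close> and \<open>Suc t\<close>. The former made her apply to \<open>c\<close> in round
  \<open>Suc t\<close>, the latter means that she was held.\<close>

lemma top_Suc_imp_top:
  assumes i: "\<mu>SF (Suc (Suc t)) i = Some c" and top: "eligible_rank M R i c = 1"
  shows "\<mu>SF (Suc t) i = Some c"
proof -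
  have a: "act (Suc t) i = Some c" using i by (simp add: \<mu>SF_Suc_eq_Some)
  then have e: "i \<in> students M" "c \<in> eligible_colleges M i" "\<not> full_above M (\<mu>SF (Suc t)) c i"
    using act_eq_Some by blast+
  then have "\<not> full_above M (\<mu>SF t) c i"
    using full_above_mono by (auto simp: eligible_colleges_def)
  moreover have "(None, Some c) \<notin> R i" using act_best_None[OF e(1)] a by metis
  ultimately have "act t i = Some c" using e top by (intro act_top)
  then show ?thesis using e by (simp add: \<mu>SF_Suc_eq_Some)
qed

section \<open>Counting students assigned below their first choice\<close>

lemma card_assigned_total:
  assumes m: "is_matching M \<mu>"
  shows "card {i \<in> students M. \<mu> i \<noteq> None} = (\<Sum>c\<in>colleges M. card (assigned M \<mu> c))"
proof -
  have "{i \<in> students M. \<mu> i \<noteq> None} = (\<Union>c\<in>colleges M. assigned M \<mu> c)"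
    using matching_eligible[OF m] by (auto simp: assigned_def eligible_colleges_def)
  then show ?thesis
    using finite_colleges finite_assigned
    by (simp add: card_UN_disjoint[symmetric] assigned_def disjoint_iff)
qed

text \<open>Lower-choice students are the assigned ones (\<open>N\<close>) minus those at their
  first choice (\<open>U\<close>). From one round to the next \<open>N\<close> does not shrink in
  number, since no college loses students on balance, and \<open>U\<close> does not grow.\<close>

lemma card_lower_ranks_mono:
  defines "L \<equiv> \<lambda>\<mu>. {i \<in> students M. \<exists>c\<in>eligible_colleges M i. 2 \<le> eligible_rank M R i c \<and> \<mu> i = Some c}"
  shows "card (L (\<mu>SF (Suc t))) \<le> card (L (\<mu>SF (Suc (Suc t))))"
proof -
  define N where "N = (\<lambda>\<mu>::('i, 'c) matching. {i \<in> students M. \<mu> i \<noteq> None})"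
  define U where "U = (\<lambda>\<mu>. {i \<in> students M. \<exists>c. eligible_rank M R i c = 1 \<and> \<mu> i = Some c})"
  have card_L: "card (L \<mu>) = card (N \<mu>) - card (U \<mu>)" if m: "is_matching M \<mu>" for \<mu>
  proof -
    \<comment> \<open>Ranks start at 1.\<close>
    have "eligible_rank M R i c \<ge> 2 \<longleftrightarrow> eligible_rank M R i c \<noteq> 1" for i c
      by (auto simp: eligible_rank_def)
    then have "L \<mu> = N \<mu> - U \<mu>"
      using matching_eligible[OF m] by (fastforce simp: L_def N_def U_def)
    moreover have "U \<mu> \<subseteq> N \<mu>" "finite (U \<mu>)" using finite_students by (auto simp: U_def N_def)
    ultimately show ?thesis by (simp add: card_Diff_subset)
  qed
  have "card (N (\<mu>SF (Suc t))) \<le> card (N (\<mu>SF (Suc (Suc t))))"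
    unfolding N_def card_assigned_total[OF is_matching_tentative]
    by (intro sum_mono card_assigned_mono)
  moreover have "card (U (\<mu>SF (Suc (Suc t)))) \<le> card (U (\<mu>SF (Suc t)))"
    using finite_students by (intro card_mono) (auto simp: U_def dest: top_Suc_imp_top)
  ultimately show ?thesis
    unfolding card_L[OF is_matching_tentative] by linarith
qed

end


section \<open>Assignment probabilities\<close>

text \<open>By linearity, a sum of probabilities is the expected number of events that occur, so it
  suffices to compare these numbers profile by profile.\<close>

lemma sum_measure_pmf_mono_card:
  assumes "finite S"
    and "\<And>x. x \<in> set_pmf P \<Longrightarrow> card {i \<in> S. x \<in> A i} \<le> card {i \<in> S. x \<in> B i}"
  shows "(\<Sum>i\<in>S. measure_pmf.prob P (A i)) \<le> (\<Sum>i\<in>S. measure_pmf.prob P (B i))"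
proof -
  have eq: "(\<Sum>i\<in>S. measure_pmf.prob P (C i)) = measure_pmf.expectation P (\<lambda>x. card {i \<in> S. x \<in> C i})"
    and int: "integrable (measure_pmf P) (\<lambda>x. real (card {i \<in> S. x \<in> C i}))" for C
  proof -
    have card: "real (card {i \<in> S. x \<in> C i}) = (\<Sum>i\<in>S. indicator (C i) x)" for x
      using assms(1) by (simp add: indicator_def sum.If_cases Int_def)
    have i: "integrable (measure_pmf P) (indicator (C i) :: _ \<Rightarrow> real)" for i
      by (rule measure_pmf.integrable_const_bound[where B = 1]) (auto simp: indicator_def)
    show "integrable (measure_pmf P) (\<lambda>x. real (card {i \<in> S. x \<in> C i}))"
      unfolding card using i by simp
    show "(\<Sum>i\<in>S. measure_pmf.prob P (C i)) = measure_pmf.expectation P (\<lambda>x. card {i \<in> S. x \<in> C i})"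
      unfolding card using i by (subst Bochner_Integration.integral_sum) auto
  qed
  show ?thesis
    unfolding eq using assms(2) by (intro integral_mono_AE int) (auto simp: AE_measure_pmf_iff)
qed

lemma measure_pmf_mono_support:
  assumes "\<And>x. x \<in> set_pmf P \<Longrightarrow> x \<in> A \<Longrightarrow> x \<in> B"
  shows "measure_pmf.prob P A \<le> measure_pmf.prob P B"
  using assms by (intro measure_pmf.finite_measure_mono_AE) (auto simp: AE_measure_pmf_iff)

text \<open>The value \<open>\<phi> R i\<close> determines the college and hence its rank, so the
  events for different \<open>l\<close> are disjoint.\<close>

lemma sum_rank_prob:
  "(\<Sum>l = 2..n. rank_prob M P \<phi> i l) = measure_pmf.prob P
     {R. \<exists>c\<in>eligible_colleges M i. eligible_rank M R i c \<in> {2..n} \<and> \<phi> R i = Some c}"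
proof -
  have "(\<Sum>l = 2..n. rank_prob M P \<phi> i l) = measure_pmf.prob P (\<Union>l\<in>{2..n}.
     {R. \<exists>c\<in>eligible_colleges M i. eligible_rank M R i c = l \<and> \<phi> R i = Some c})"
    unfolding rank_prob_def
    by (rule measure_pmf.finite_measure_finite_Union[symmetric]) (auto simp: disjoint_family_on_def)
  also have "(\<Union>l\<in>{2..n}.
     {R. \<exists>c\<in>eligible_colleges M i. eligible_rank M R i c = l \<and> \<phi> R i = Some c}) =
     {R. \<exists>c\<in>eligible_colleges M i. eligible_rank M R i c \<in> {2..n} \<and> \<phi> R i = Some c}"
    by auto
  finally show ?thesis .
qed

theorem mainTheorem8:
  fixes M :: "('i, 'c) admissions"
  assumes "admissions_problem M"
  shows
    "(\<forall>R\<in>preference_profiles M.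
       (\<exists>!\<mu>. stable_matching M R \<mu>) \<and>
       stable_matching M R (serial_dictatorship M R) \<and>
       (\<exists>n\<le>card (students M). \<forall>t\<ge>n.
          tentative M (straightforward M R) t = serial_dictatorship M R) \<and>
       (\<forall>T\<ge>card (students M). TCDM M T R = serial_dictatorship M R)) \<and>
     (\<forall>R\<in>preference_profiles M. \<forall>T\<ge>card (students M).
       nash_equilibrium M R T (straightforward M R)) \<and>
     (\<forall>R\<in>preference_profiles M. \<forall>T\<ge>1. \<forall>i\<in>students M.
       (TCDM M T R i, DA M R i) \<in> R i \<longrightarrow>
       (\<exists>j\<in>students M. priority M j i \<and> TCDM M T R j = None)) \<and>
     (\<forall>T\<ge>1. \<forall>P. set_pmf P \<subseteq> preference_profiles M \<longrightarrow>
       (\<forall>i\<in>students M. rank_prob M P (TCDM M T) i 1 \<ge> rank_prob M P (DA M) i 1)) \<and>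
     (\<forall>T\<ge>1. \<forall>P. set_pmf P \<subseteq> preference_profiles M \<longrightarrow>
       (\<forall>i\<in>students M. rank_prob M P (TCDM M T) i 1 \<ge> rank_prob M P (TCDM M (T + 1)) i 1) \<and>
       (\<Sum>i\<in>students M. \<Sum>l = 2..card (eligible_colleges M i). rank_prob M P (TCDM M T) i l)
         \<le> (\<Sum>i\<in>students M. \<Sum>l = 2..card (eligible_colleges M i).
               rank_prob M P (TCDM M (T + 1)) i l))"
proof -
  interpret admissions_market M by (standard) (rule assms)
  let ?SD = "serial_dictatorship M"
  have prof: "admissions_profile M R" if "R \<in> preference_profiles M" for R
    using that by unfold_locales
  have stable: "stable_matching M R (?SD R)" if "R \<in> preference_profiles M" for R
    by (rule admissions_profile.stable_serial_dictatorship[OF prof[OF that]])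
  have unique: "\<exists>!\<mu>. stable_matching M R \<mu>" if "R \<in> preference_profiles M" for R
    using stable[OF that] admissions_profile.stable_unique[OF prof[OF that]] by blast
  have final: "TCDM M T R = ?SD R"
    if "R \<in> preference_profiles M" "card (students M) \<le> T" for R T
    unfolding TCDM_def
    using prof[OF that(1)] stable[OF that(1)] that(2) by (rule admissions_profile.tentative_eq_stable)
  have converges: "\<exists>n\<le>card (students M). \<forall>t\<ge>n. tentative M (straightforward M R) t = ?SD R"
    if "R \<in> preference_profiles M" for R
    \<comment> \<open>The witness is \<open>n = card (students M)\<close>.\<close>
    using final[OF that] unfolding TCDM_def by blast
  have nash: "nash_equilibrium M R T (straightforward M R)"
    if "R \<in> preference_profiles M" "card (students M) \<le> T" for R T
    using prof[OF that(1)] that(2) by (rule admissions_profile.nash_equilibrium_straightforward)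
  have above: "\<exists>j\<in>students M. priority M j i \<and> TCDM M T R j = None"
    if "R \<in> preference_profiles M" "1 \<le> T" "i \<in> students M" "(TCDM M T R i, DA M R i) \<in> R i"
    for R T i
  proof -
    interpret admissions_profile M R using that(1) by (rule prof)
    show ?thesis
      \<comment> \<open>The round lemmas speak of \<open>Suc t\<close>; with
        \<open>1 \<le> T\<close>, taking \<open>t = T - 1\<close> gives round
        \<open>T\<close>.\<close>
      using unassigned_above_of_preferred[OF DA_stable, of i "T - 1"] that by (simp add: TCDM_def)
  qed
  have top_DA: "rank_prob M P (DA M) i 1 \<le> rank_prob M P (TCDM M T) i 1"
    if T: "1 \<le> T" and P: "set_pmf P \<subseteq> preference_profiles M" for T P i
    unfolding rank_prob_def
  proof (rule measure_pmf_mono_support)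
    fix R assume "R \<in> set_pmf P"
    then interpret admissions_profile M R using P prof by blast
    assume "R \<in> {R. \<exists>c\<in>eligible_colleges M i. eligible_rank M R i c = 1 \<and> DA M R i = Some c}"
    then show "R \<in> {R. \<exists>c\<in>eligible_colleges M i. eligible_rank M R i c = 1 \<and> TCDM M T R i = Some c}"
      using top_stable_imp_top_TCDM[OF DA_stable, of i _ "T - 1"] T unfolding TCDM_def by auto
  qed
  have top_Suc: "rank_prob M P (TCDM M (T + 1)) i 1 \<le> rank_prob M P (TCDM M T) i 1"
    if T: "1 \<le> T" and P: "set_pmf P \<subseteq> preference_profiles M" for T P i
    unfolding rank_prob_def
  proof (rule measure_pmf_mono_support)
    fix R assume "R \<in> set_pmf P"
    then interpret admissions_profile M R using P prof by blast
    assume "R \<in> {R. \<exists>c\<in>eligible_colleges M i. eligible_rank M R i c = 1 \<and> TCDM M (T + 1) R i = Some c}"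
    then show "R \<in> {R. \<exists>c\<in>eligible_colleges M i. eligible_rank M R i c = 1 \<and> TCDM M T R i = Some c}"
      using top_Suc_imp_top[of "T - 1" i] T unfolding TCDM_def by auto
  qed
  have lower: "(\<Sum>i\<in>students M. \<Sum>l = 2..card (eligible_colleges M i). rank_prob M P (TCDM M T) i l)
      \<le> (\<Sum>i\<in>students M. \<Sum>l = 2..card (eligible_colleges M i). rank_prob M P (TCDM M (T + 1)) i l)"
    if T: "1 \<le> T" and P: "set_pmf P \<subseteq> preference_profiles M" for T P
    unfolding sum_rank_prob
  proof (rule sum_measure_pmf_mono_card[OF finite_students])
    fix R assume "R \<in> set_pmf P"
    then interpret admissions_profile M R using P prof by blast
    show "card {i \<in> students M. R \<in> {R. \<exists>c\<in>eligible_colleges M i.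
          eligible_rank M R i c \<in> {2..card (eligible_colleges M i)} \<and> TCDM M T R i = Some c}}
      \<le> card {i \<in> students M. R \<in> {R. \<exists>c\<in>eligible_colleges M i.
          eligible_rank M R i c \<in> {2..card (eligible_colleges M i)} \<and> TCDM M (T + 1) R i = Some c}}"
      \<comment> \<open>By \<open>eligible_rank_le\<close> membership in
        \<open>{2..card (eligible_colleges M i)}\<close> reduces to rank at least 2.\<close>
      using card_lower_ranks_mono[of "T - 1"] eligible_rank_le T
      by (simp add: TCDM_def cong: conj_cong)
  qed
  show ?thesis
    by (intro conjI ballI allI impI)
      (rule unique stable converges final nash above top_DA top_Suc lower; assumption)+
qed

end
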